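(* Let $\{\pi,\mathcal{H}\}$ be a $\ast$-representation of a $C^{\ast}$-algebra $\mathcal{A}$ over $\mathbb{C}$. Then $\{\pi,\mathcal{H}\}$ is irreducible if and only if there is no Rota-Baxter operator of weight $-1$ on $B(\mathcal{H})$ which, for some nontrivial projection $p$ on $\mathcal{H}$, is symmetric on $\pi(\mathcal{A})$ and matches $p$ on $\pi(\mathcal{A})$.
   Context: $B(\mathcal{H})$ is the $C^{\ast}$-algebra of bounded linear operators on a complex Hilbert space $\mathcal{H}$, and $a.x$ denotes $a(x)$. A $\ast$-representation $\{\pi,\mathcal{H}\}$ of $\mathcal{A}$ is a $\ast$-homomorphism $\pi:\mathcal{A}\to B(\mathcal{H})$ with $\mathcal{H}$ a complex Hilbert space. It is irreducible if $\pi(\mathcal{A})$ has no closed invariant subspace other than $\{0\}$ and $\mathcal{H}$ (for $C^{\ast}$-algebras this is equivalent to having no invariant linear subspace, closed or not, other than $\{0\}$ and $\mathcal{H}$). A projection is $p\in B(\mathcal{H})$ with $p^2=p=p^{\ast}$; it is nontrivial if $p\neq 0$ and $p\neq\mathrm{id}_{\mathcal{H}}$. A Rota-Baxter operator of weight $\lambda\in\mathbb{C}$ on $B(\mathcal{H})$ is a linear map $P:B(\mathcal{H})\to B(\mathcal{H})$ with $P(a)P(b)=P(aP(b))+P(P(a)b)+\lambda P(ab)$ for all $a,b$. It is symmetric on a $C^{\ast}$-subalgebra $\mathcal{A}_1\subseteq B(\mathcal{H})$ if $P(a^{\ast})=P(a)^{\ast}$ for all $a\in\mathcal{A}_1$.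 For a linear operator $f$ on $\mathcal{H}$, it is said to match $f$ on $\mathcal{A}_1$ if $P(a).f(x)=f(P(a).x)+f(a.f(x))+\lambda f(a.x)$ for all $a\in\mathcal{A}_1$ and $x\in\mathcal{H}$. *)

theory Defs
  imports "HOL-Analysis.Analysis"
begin

subsection \<open>Complex normed spaces, Hilbert spaces and C*-algebras\<close>

text \<open>
  The classes refine their real counterparts: the real scalar multiplication is the restriction
  of the complex one, so norm, topology and completeness are those of the library.
\<close>

class scaleC = scaleR +
  fixes scaleC :: "complex \<Rightarrow> 'a \<Rightarrow> 'a" (infixr \<open>*\<^sub>C\<close> 75)
  assumes scaleR_scaleC: "r *\<^sub>R x = complex_of_real r *\<^sub>C x"

class complex_vector = scaleC + real_vector +
  assumes scaleC_add_right: "c *\<^sub>C (x + y) = c *\<^sub>C x + c *\<^sub>C y"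
    and scaleC_add_left: "(c + d) *\<^sub>C x = c *\<^sub>C x + d *\<^sub>C x"
    and scaleC_scaleC: "c *\<^sub>C d *\<^sub>C x = (c * d) *\<^sub>C x"
    and scaleC_one: "1 *\<^sub>C x = x"

global_interpretation complex_vector:
  vector_space "scaleC :: complex \<Rightarrow> 'a \<Rightarrow> 'a::complex_vector"
  by unfold_locales (simp_all add: scaleC_add_right scaleC_add_left scaleC_scaleC scaleC_one)

abbreviation csubspace :: "'a::complex_vector set \<Rightarrow> bool"
  where "csubspace \<equiv> module.subspace scaleC"

abbreviation clinear :: "('a::complex_vector \<Rightarrow> 'b::complex_vector) \<Rightarrow> bool"
  where "clinear \<equiv> Vector_Spaces.linear scaleC scaleC"

lemma clinear_iff:
  "clinear f \<longleftrightarrow> (\<forall>x y. f (x + y) = f x + f y) \<and> (\<forall>c x. f (c *\<^sub>C x) = c *\<^sub>C f x)"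
  by (simp add: Vector_Spaces.linear_iff complex_vector.vector_space_axioms)

class complex_normed_vector = complex_vector + real_normed_vector +
  assumes norm_scaleC: "norm (c *\<^sub>C x) = cmod c * norm x"

text \<open>The inner product is antilinear in its first and linear in its second argument.\<close>

class complex_inner = complex_normed_vector +
  fixes cinner :: "'a \<Rightarrow> 'a \<Rightarrow> complex"
  assumes cinner_commute: "cinner x y = cnj (cinner y x)"
    and cinner_add_right: "cinner x (y + z) = cinner x y + cinner x z"
    and cinner_scaleC_right: "cinner x (c *\<^sub>C y) = c * cinner x y"
    and cinner_self: "cinner x x = complex_of_real ((norm x)\<^sup>2)"

class chilbert_space = complex_inner + banach

text \<open>C*-algebras are not assumed to be unital.\<close>

class cstar_algebra = complex_normed_vector + real_normed_algebra + banach +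
  fixes star :: "'a \<Rightarrow> 'a"
  assumes mult_scaleC_left: "(c *\<^sub>C a) * b = c *\<^sub>C (a * b)"
    and mult_scaleC_right: "a * (c *\<^sub>C b) = c *\<^sub>C (a * b)"
    and star_add: "star (a + b) = star a + star b"
    and star_scaleC: "star (c *\<^sub>C a) = cnj c *\<^sub>C star a"
    and star_mult: "star (a * b) = star b * star a"
    and star_star: "star (star a) = a"
    and cstar_identity: "norm (star a * a) = (norm a)\<^sup>2"

definition star_hom :: "('a::cstar_algebra \<Rightarrow> 'b::cstar_algebra) \<Rightarrow> bool"
  where "star_hom \<phi> \<longleftrightarrow> clinear \<phi> \<and> (\<forall>a b. \<phi> (a * b) = \<phi> a * \<phi> b) \<and> (\<forall>a. \<phi> (star a) = star (\<phi> a))"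


subsection \<open>Hilbert space facts needed for the existence of adjoints\<close>

context complex_inner
begin

lemma cinner_add_left: "cinner (x + y) z = cinner x z + cinner y z"
  by (metis cinner_commute cinner_add_right complex_cnj_add)

lemma cinner_scaleC_left: "cinner (c *\<^sub>C x) y = cnj c * cinner x y"
  by (metis cinner_commute cinner_scaleC_right complex_cnj_mult)

lemma norm_add_sq: "(norm (x + y))\<^sup>2 = (norm x)\<^sup>2 + 2 * Re (cinner x y) + (norm y)\<^sup>2"
proof -
  have "Re (cinner (x + y) (x + y)) = Re (cinner x x) + Re (cinner x y) + Re (cinner y x) + Re (cinner y y)"
    by (simp add: cinner_add_left cinner_add_right)
  moreover have "Re (cinner y x) = Re (cinner x y)"
    by (subst cinner_commute) simp
  ultimately show ?thesis by (simp add: cinner_self)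
qed

lemma Re_cinner_le: "Re (cinner x y) \<le> norm x * norm y"
proof -
  have "(norm (x + y))\<^sup>2 \<le> (norm x + norm y)\<^sup>2"
    by (intro power_mono norm_triangle_ineq) simp
  then show ?thesis unfolding norm_add_sq by (simp add: power2_sum)
qed

lemma cmod_cinner_le: "cmod (cinner x y) \<le> norm x * norm y"
proof -
  define z where "z = cinner x y"
  have "Re (cinner x (cnj z *\<^sub>C y)) = (cmod z)\<^sup>2"
    by (simp add: cinner_scaleC_right z_def[symmetric] cmod_power2) (simp add: power2_eq_square)
  then have "(cmod z)\<^sup>2 \<le> norm x * (cmod z * norm y)"
    using Re_cinner_le[of x "cnj z *\<^sub>C y"] by (simp add: norm_scaleC)
  then show ?thesis
    by (cases "cmod z = 0") (auto simp: z_def power2_eq_square mult.left_commute)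
qed

end

lemma cinner_eqI:
  fixes x y :: "'a::complex_inner"
  assumes "\<And>z. cinner x z = cinner y z"
  shows "x = y"
proof -
  have "cinner (x - y) z = 0" for z
    using cinner_add_left[of "x - y" y z] assms by simp
  then have "norm (x - y) = 0"
    using cinner_self[of "x - y"] by simp
  then show ?thesis by simp
qed

lemma riesz_representation:
  fixes \<phi> :: "'h::chilbert_space \<Rightarrow> complex"
  assumes bl: "bounded_linear \<phi>" and sc: "\<And>c x. \<phi> (c *\<^sub>C x) = c * \<phi> x"
  shows "\<exists>z. \<forall>x. \<phi> x = cinner z x"
proof -
  interpret \<phi>: bounded_linear \<phi> by (rule bl)
  define J where "J x = (norm x)\<^sup>2 - 2 * Re (\<phi> x)" for x
  obtain K where K: "\<And>x. cmod (\<phi> x) \<le> norm x * K" using \<phi>.bounded by blast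
  have lb: "J x \<ge> - K\<^sup>2" for x
  proof -
    have "Re (\<phi> x) \<le> norm x * K" using K[of x] complex_Re_le_cmod order_trans by blast
    moreover have "0 \<le> (norm x - K)\<^sup>2" by simp
    ultimately show ?thesis unfolding J_def by (simp add: power2_diff)
  qed
  have bdd: "bdd_below (range J)" using lb by (intro bdd_belowI2)
  define m where "m = (INF x. J x)"
  have m_le: "m \<le> J x" for x unfolding m_def by (intro cINF_lower bdd) simp
  have "\<exists>x. J x < m + 1 / real (Suc n)" for n
    using cINF_less_iff[OF _ bdd, of "m + 1 / real (Suc n)"] unfolding m_def by auto
  then obtain X where X: "\<And>n. J (X n) < m + 1 / real (Suc n)" by metis
  have par: "(norm (x - y))\<^sup>2 \<le> 2 * (J x - m) + 2 * (J y - m)" for x y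
  proof -
    have "(norm (x - y))\<^sup>2 + (norm (x + y))\<^sup>2 = 2 * (norm x)\<^sup>2 + 2 * (norm y)\<^sup>2"
    proof -
      have "Re (cinner x (- y)) = - Re (cinner x y)" using cinner_scaleC_right[of x "-1" y] by simp
      then show ?thesis using norm_add_sq[of x "- y"] norm_add_sq[of x y] by simp
    qed
    moreover have "4 * J ((1/2) *\<^sub>R (x + y)) = (norm (x + y))\<^sup>2 - 4 * Re (\<phi> x) - 4 * Re (\<phi> y)"
    proof -
      have "norm ((1/2) *\<^sub>R (x + y)) = norm (x + y) / 2" unfolding norm_scaleR by simp
      moreover have "Re (\<phi> ((1/2) *\<^sub>R (x + y))) = (Re (\<phi> x) + Re (\<phi> y)) / 2"
        by (simp only: \<phi>.scaleR \<phi>.add) simp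
      ultimately show ?thesis unfolding J_def by (simp add: power_divide)
    qed
    moreover have "m \<le> J ((1/2) *\<^sub>R (x + y))" by (rule m_le)
    ultimately show ?thesis unfolding J_def by argo
  qed
  have "Cauchy X"
  proof (rule metric_CauchyI)
    fix e :: real assume e: "e > 0"
    then have "e\<^sup>2 / 4 > 0" by simp
    then obtain N where N: "inverse (real (Suc N)) < e\<^sup>2 / 4" using reals_Archimedean by blast
    have "dist (X i) (X j) < e" if "i \<ge> N" "j \<ge> N" for i j
    proof -
      have small: "J (X k) - m < e\<^sup>2 / 4" if "k \<ge> N" for k
      proof -
        have "1 / real (Suc k) \<le> inverse (real (Suc N))" using that by (simp add: field_simps)
        then show ?thesis using X[of k] N by linarith
      qed
      have "(norm (X i - X j))\<^sup>2 < e\<^sup>2" using par[of "X i" "X j"] small[OF that(1)] small[OF that(2)] by argo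
      then show ?thesis using e by (simp add: dist_norm power_less_imp_less_base)
    qed
    then show "\<exists>M. \<forall>i\<ge>M. \<forall>j\<ge>M. dist (X i) (X j) < e" by blast
  qed
  then obtain z where z: "X \<longlonglongrightarrow> z" using Cauchy_convergent convergent_def by blast
  have "(\<lambda>n. J (X n)) \<longlonglongrightarrow> J z"
    unfolding J_def by (intro tendsto_intros z \<phi>.tendsto)
  moreover have "(\<lambda>n. m + 1 / real (Suc n)) \<longlonglongrightarrow> m + 0"
    by (intro tendsto_intros LIMSEQ_Suc[OF lim_1_over_n])
  ultimately have "J z \<le> m + 0"
    by (rule LIMSEQ_le) (use X less_imp_le in blast)
  then have min: "J z \<le> J x" for x using m_le[of x] by simp
  have re: "Re (cinner z v) = Re (\<phi> v)" for v
  proof -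
    define d where "d = Re (cinner z v) - Re (\<phi> v)"
    have q: "0 \<le> 2 * t * d + t\<^sup>2 * (norm v)\<^sup>2" for t :: real
    proof -
      have "Re (cinner z (t *\<^sub>R v)) = t * Re (cinner z v)"
        by (simp add: scaleR_scaleC cinner_scaleC_right)
      then have "J (z + t *\<^sub>R v) - J z = 2 * t * d + t\<^sup>2 * (norm v)\<^sup>2"
        unfolding J_def norm_add_sq \<phi>.add \<phi>.scaleR d_def
        by (simp add: power_mult_distrib algebra_simps)
      then show ?thesis using min[of "z + t *\<^sub>R v"] by simp
    qed
    have "d = 0"
    proof (cases "norm v = 0")
      case True
      then show ?thesis using q[of "-d"] by (simp add: power2_eq_square[symmetric])
    next
      case False
      then have "0 \<le> - (d\<^sup>2 / (norm v)\<^sup>2)"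
        using q[of "- d / (norm v)\<^sup>2"] by (simp add: power2_eq_square field_simps)
      then have "d\<^sup>2 / (norm v)\<^sup>2 \<le> 0" by simp
      then show ?thesis using False by (simp add: divide_le_0_iff)
    qed
    then show ?thesis unfolding d_def by simp
  qed
  have "\<phi> v = cinner z v" for v
  proof (rule complex_eqI)
    show "Re (\<phi> v) = Re (cinner z v)" using re by simp
    show "Im (\<phi> v) = Im (cinner z v)" using re[of "\<i> *\<^sub>C v"] by (simp add: sc cinner_scaleC_right)
  qed
  then show ?thesis by blast
qed


subsection \<open>The C*-algebra of bounded operators\<close>

typedef (overloaded) ('h::complex_normed_vector) bop =
  "{f :: 'h \<Rightarrow>\<^sub>L 'h. \<forall>c x. blinfun_apply f (c *\<^sub>C x) = c *\<^sub>C blinfun_apply f x}"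
  by (rule exI[of _ 0]) simp

setup_lifting type_definition_bop

lift_definition bop_apply :: "'h::complex_normed_vector bop \<Rightarrow> 'h \<Rightarrow> 'h" (infixl \<open>\<cdot>\<close> 90)
  is blinfun_apply .

lemma bop_eqI: "(\<And>x. a \<cdot> x = b \<cdot> x) \<Longrightarrow> a = b"
  by transfer (rule blinfun_eqI)

lemma bounded_linear_scaleC: "bounded_linear (\<lambda>x :: 'a::complex_normed_vector. c *\<^sub>C x)"
  by (rule bounded_linear_intro[where K = "cmod c"])
    (simp_all add: scaleC_add_right scaleR_scaleC scaleC_scaleC norm_scaleC mult.commute)

instantiation bop :: (complex_normed_vector) "{complex_normed_vector, real_normed_algebra, monoid_mult}"
begin

lift_definition zero_bop :: "'a bop" is 0 by simp
lift_definition plus_bop :: "'a bop \<Rightarrow> 'a bop \<Rightarrow> 'a bop" is "(+)"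
  by (simp add: blinfun.add_left scaleC_add_right)
lift_definition uminus_bop :: "'a bop \<Rightarrow> 'a bop" is uminus
  by (simp add: blinfun.minus_left)
lift_definition minus_bop :: "'a bop \<Rightarrow> 'a bop \<Rightarrow> 'a bop" is "(-)"
  by (simp add: blinfun.diff_left complex_vector.scale_right_diff_distrib)
lift_definition scaleR_bop :: "real \<Rightarrow> 'a bop \<Rightarrow> 'a bop" is scaleR
  by (simp add: blinfun.scaleR_left scaleR_scaleC scaleC_scaleC mult.commute)
lift_definition scaleC_bop :: "complex \<Rightarrow> 'a bop \<Rightarrow> 'a bop"
  is "\<lambda>c f. Blinfun (\<lambda>x. c *\<^sub>C blinfun_apply f x)"
  by (simp add: bounded_linear_Blinfun_apply bounded_linear_compose[OF bounded_linear_scaleC]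
      scaleC_scaleC mult.commute blinfun.bounded_linear_right)
lift_definition one_bop :: "'a bop" is id_blinfun by simp
lift_definition times_bop :: "'a bop \<Rightarrow> 'a bop \<Rightarrow> 'a bop" is "(o\<^sub>L)" by simp
lift_definition norm_bop :: "'a bop \<Rightarrow> real" is norm .
definition dist_bop :: "'a bop \<Rightarrow> 'a bop \<Rightarrow> real" where "dist_bop a b = norm (a - b)"
definition sgn_bop :: "'a bop \<Rightarrow> 'a bop" where "sgn_bop a = inverse (norm a) *\<^sub>R a"
definition uniformity_bop :: "('a bop \<times> 'a bop) filter"
  where "uniformity_bop = (INF e\<in>{0 <..}. principal {(x, y). dist x y < e})"
definition open_bop :: "'a bop set \<Rightarrow> bool"
  where "open_bop U = (\<forall>x\<in>U. \<forall>\<^sub>F (x', y) in uniformity. x' = x \<longrightarrow> y \<in> U)"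

lemma bop_add_apply: "(a + b) \<cdot> (x::'a) = a \<cdot> x + b \<cdot> x"
  by transfer (simp add: blinfun.add_left)
lemma bop_scaleC_apply: "(c *\<^sub>C a) \<cdot> (x::'a) = c *\<^sub>C (a \<cdot> x)"
  by transfer (simp add: bounded_linear_Blinfun_apply
      bounded_linear_compose[OF bounded_linear_scaleC] blinfun.bounded_linear_right)
lemma bop_scaleR_apply: "(r *\<^sub>R a) \<cdot> (x::'a) = r *\<^sub>R (a \<cdot> x)"
  by transfer (simp add: blinfun.scaleR_left)
lemma bop_mult_apply: "(a * b) \<cdot> (x::'a) = a \<cdot> (b \<cdot> x)"
  by transfer simp
lemma bop_one_apply: "1 \<cdot> (x::'a) = x"
  by transfer simp
lemma bop_zero_apply: "0 \<cdot> (x::'a) = 0"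
  by transfer simp
lemma bop_apply_add: "a \<cdot> (x + y) = a \<cdot> x + a \<cdot> (y::'a)"
  by transfer (simp add: blinfun.add_right)
lemma bop_apply_scaleC: "a \<cdot> (c *\<^sub>C x) = c *\<^sub>C (a \<cdot> (x::'a))"
  by transfer simp
lemma bop_apply_scaleR: "a \<cdot> (r *\<^sub>R x) = r *\<^sub>R (a \<cdot> (x::'a))"
  by (simp add: scaleR_scaleC bop_apply_scaleC)
lemma norm_bop_apply: "norm (a \<cdot> (x::'a)) \<le> norm a * norm x"
  by transfer (rule norm_blinfun)
lemma norm_bop_bound: "0 \<le> k \<Longrightarrow> (\<And>x::'a. norm (a \<cdot> x) \<le> k * norm x) \<Longrightarrow> norm a \<le> k"
  by transfer (rule norm_blinfun_bound)

instance
proof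
  fix a b c :: "'a bop" and r s :: real and z w :: complex
  show "a + b + c = a + (b + c)" "a + b = b + a" "0 + a = a" "- a + a = 0" "a - b = a + - b"
    by (transfer; simp)+
  show "r *\<^sub>R (a + b) = r *\<^sub>R a + r *\<^sub>R b" "(r + s) *\<^sub>R a = r *\<^sub>R a + s *\<^sub>R a"
    "r *\<^sub>R s *\<^sub>R a = (r * s) *\<^sub>R a" "1 *\<^sub>R a = a"
    by (transfer; simp add: algebra_simps)+
  show "r *\<^sub>R a = complex_of_real r *\<^sub>C a"
    by (rule bop_eqI) (simp add: bop_scaleC_apply bop_scaleR_apply scaleR_scaleC)
  show "z *\<^sub>C (a + b) = z *\<^sub>C a + z *\<^sub>C b" "(z + w) *\<^sub>C a = z *\<^sub>C a + w *\<^sub>C a"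
    "z *\<^sub>C w *\<^sub>C a = (z * w) *\<^sub>C a" "1 *\<^sub>C a = a"
    by (rule bop_eqI; simp add: bop_scaleC_apply bop_add_apply scaleC_add_right scaleC_add_left
        scaleC_scaleC scaleC_one)+
  show "a * b * c = a * (b * c)" "1 * a = a" "a * 1 = a"
    "(a + b) * c = a * c + b * c" "a * (b + c) = a * b + a * c"
    by (rule bop_eqI; simp add: bop_mult_apply bop_add_apply bop_one_apply bop_apply_add)+
  show "(r *\<^sub>R a) * b = r *\<^sub>R (a * b)" "a * (r *\<^sub>R b) = r *\<^sub>R (a * b)"
    by (rule bop_eqI; simp add: bop_mult_apply bop_scaleR_apply bop_apply_scaleR)+
  show "sgn a = inverse (norm a) *\<^sub>R a" by (rule sgn_bop_def)
  show "dist a b = norm (a - b)" by (rule dist_bop_def)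
  show "(uniformity :: ('a bop \<times> 'a bop) filter) = (INF e\<in>{0 <..}. principal {(x, y). dist x y < e})"
    by (rule uniformity_bop_def)
  show "open U = (\<forall>x\<in>U. \<forall>\<^sub>F (x', y) in uniformity. x' = x \<longrightarrow> y \<in> U)" for U :: "'a bop set"
    by (rule open_bop_def)
  show "norm a = 0 \<longleftrightarrow> a = 0" by transfer simp
  show "norm (a + b) \<le> norm a + norm b" by transfer (rule norm_triangle_ineq)
  show "norm (r *\<^sub>R a) = \<bar>r\<bar> * norm a" by transfer simp
  show "norm (a * b) \<le> norm a * norm b" by transfer (rule norm_blinfun_compose)
  have le: "norm (u *\<^sub>C d) \<le> cmod u * norm d" for u and d :: "'a bop"
  proof (rule norm_bop_bound)
    fix x show "norm ((u *\<^sub>C d) \<cdot> x) \<le> cmod u * norm d * norm x"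
      using mult_left_mono[OF norm_bop_apply[of d x], of "cmod u"]
      by (simp add: bop_scaleC_apply norm_scaleC mult.assoc)
  qed (rule mult_nonneg_nonneg, simp, transfer, simp)
  show "norm (z *\<^sub>C a) = cmod z * norm a"
  proof (cases "z = 0")
    case True
    have "(0::complex) *\<^sub>C a = 0" by (rule bop_eqI) (simp add: bop_scaleC_apply bop_zero_apply)
    then show ?thesis using True by (simp; transfer; simp)
  next
    case False
    have "inverse z *\<^sub>C z *\<^sub>C a = a"
      by (rule bop_eqI) (use False in \<open>simp add: bop_scaleC_apply\<close>)
    then have "norm a \<le> cmod (inverse z) * norm (z *\<^sub>C a)"
      using le[of "inverse z" "z *\<^sub>C a"] by simp
    then have "cmod z * norm a \<le> norm (z *\<^sub>C a)"
      using False by (simp add: norm_divide field_simps)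
    then show ?thesis using le[of z a] by simp
  qed
qed

end

lemma clinear_bop_apply: "clinear ((\<cdot>) a)"
  by (simp add: clinear_iff bop_apply_add bop_apply_scaleC)

instance bop :: ("{complex_normed_vector, banach}") banach
proof
  fix X :: "nat \<Rightarrow> 'a bop" assume C: "Cauchy X"
  define Y where "Y n = Rep_bop (X n)" for n
  have d: "dist (Rep_bop a) (Rep_bop b) = dist a b" for a b :: "'a bop"
    unfolding dist_norm by transfer simp
  have "Cauchy Y" using C unfolding Cauchy_def Y_def d .
  then obtain L where L: "Y \<longlonglongrightarrow> L" using Cauchy_convergent convergent_def by blast
  have lim: "(\<lambda>n. blinfun_apply (Y n) x) \<longlonglongrightarrow> blinfun_apply L x" for x
    by (intro tendsto_intros L)
  have "blinfun_apply L (c *\<^sub>C x) = c *\<^sub>C blinfun_apply L x" for c x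
  proof (rule LIMSEQ_unique[OF lim])
    have "blinfun_apply (Y n) (c *\<^sub>C x) = c *\<^sub>C blinfun_apply (Y n) x" for n
      unfolding Y_def using Rep_bop[of "X n"] by simp
    then show "(\<lambda>n. blinfun_apply (Y n) (c *\<^sub>C x)) \<longlonglongrightarrow> c *\<^sub>C blinfun_apply L x"
      using bounded_linear.tendsto[OF bounded_linear_scaleC lim] by simp
  qed
  then have "Rep_bop (Abs_bop L) = L" by (simp add: Abs_bop_inverse)
  then have "(\<lambda>n. dist (X n) (Abs_bop L)) \<longlonglongrightarrow> 0"
    using L unfolding Y_def tendsto_dist_iff[of _ L] by (simp add: d[symmetric])
  then show "convergent X" unfolding convergent_def by (blast intro: tendsto_dist_iff[THEN iffD2])
qed

lemma adjoint_exists: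
  fixes a :: "'h::chilbert_space bop"
  shows "\<exists>!b :: 'h bop. \<forall>x y. cinner (b \<cdot> x) y = cinner x (a \<cdot> y)"
proof -
  have "\<exists>z. \<forall>y. cinner x (a \<cdot> y) = cinner z y" for x
  proof (rule riesz_representation)
    show "bounded_linear (\<lambda>y. cinner x (a \<cdot> y))"
    proof (rule bounded_linear_intro[where K = "norm x * norm a"])
      show "cmod (cinner x (a \<cdot> y)) \<le> norm y * (norm x * norm a)" for y
        using cmod_cinner_le[of x "a \<cdot> y"] mult_left_mono[OF norm_bop_apply[of a y], of "norm x"]
        by (simp add: mult_ac)
    qed (simp_all add: bop_apply_add cinner_add_right scaleR_scaleC bop_apply_scaleC
        cinner_scaleC_right scaleR_conv_of_real)
  qed (simp add: bop_apply_scaleC cinner_scaleC_right)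
  then obtain g where g: "\<And>x y. cinner (g x) y = cinner x (a \<cdot> y)" by metis
  have add: "g (x + y) = g x + g y" for x y
    by (rule cinner_eqI) (simp add: g cinner_add_left)
  have sc: "g (c *\<^sub>C x) = c *\<^sub>C g x" for c x
    by (rule cinner_eqI) (simp add: g cinner_scaleC_left)
  have bound: "norm (g x) \<le> norm x * norm a" for x
  proof -
    have "(norm (g x))\<^sup>2 = cmod (cinner x (a \<cdot> g x))"
      unfolding g[symmetric] cinner_self norm_of_real by simp
    also have "\<dots> \<le> norm x * (norm a * norm (g x))"
      using cmod_cinner_le[of x "a \<cdot> g x"] mult_left_mono[OF norm_bop_apply[of a "g x"], of "norm x"]
      by simp
    finally show ?thesis
      by (cases "norm (g x) = 0") (auto simp: power2_eq_square mult.assoc[symmetric])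
  qed
  have "bounded_linear g"
    by (rule bounded_linear_intro[OF add _ bound]) (simp add: scaleR_scaleC sc)
  then have "Abs_bop (Blinfun g) \<cdot> x = g x" for x
    by (simp add: bop_apply.rep_eq Abs_bop_inverse bounded_linear_Blinfun_apply sc)
  then have ex: "\<forall>x y. cinner (Abs_bop (Blinfun g) \<cdot> x) y = cinner x (a \<cdot> y)"
    using g by simp
  show ?thesis
  proof (rule ex1I[where a = "Abs_bop (Blinfun g)"])
    show "\<forall>x y. cinner (Abs_bop (Blinfun g) \<cdot> x) y = cinner x (a \<cdot> y)" by (rule ex)
  next
    fix b assume "\<forall>x y. cinner (b \<cdot> x) y = cinner x (a \<cdot> y)"
    then show "b = Abs_bop (Blinfun g)"
      using ex by (intro bop_eqI cinner_eqI) simp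
  qed
qed

instantiation bop :: (chilbert_space) cstar_algebra
begin

definition star_bop :: "'a bop \<Rightarrow> 'a bop"
  where "star_bop a = (THE b. \<forall>x y. cinner (b \<cdot> x) y = cinner x (a \<cdot> y))"

lemma cinner_star_left: "cinner (star a \<cdot> x) y = cinner x (a \<cdot> (y::'a))"
  using theI'[OF adjoint_exists[of a]] unfolding star_bop_def by blast

lemma cinner_star_right: "cinner x (star a \<cdot> y) = cinner (a \<cdot> x) (y::'a)"
  by (metis cinner_star_left cinner_commute)

instance
proof
  fix a b :: "'a bop" and c :: complex
  show "(c *\<^sub>C a) * b = c *\<^sub>C (a * b)" "a * (c *\<^sub>C b) = c *\<^sub>C (a * b)"
    by (rule bop_eqI; simp add: bop_mult_apply bop_scaleC_apply bop_apply_scaleC)+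
  show "star (a + b) = star a + star b" "star (c *\<^sub>C a) = cnj c *\<^sub>C star a"
    "star (a * b) = star b * star a" "star (star a) = a"
    by (rule bop_eqI, rule cinner_eqI; simp add: cinner_star_left bop_add_apply bop_scaleC_apply
        bop_mult_apply cinner_add_left cinner_add_right cinner_scaleC_left cinner_scaleC_right
        cinner_star_right)+
  have star_le: "norm (star d) \<le> norm d" for d :: "'a bop"
  proof (rule norm_bop_bound)
    fix x
    have "(norm (star d \<cdot> x))\<^sup>2 = cmod (cinner x (d \<cdot> (star d \<cdot> x)))"
      unfolding cinner_star_left[symmetric] cinner_self norm_of_real by simp
    also have "\<dots> \<le> norm x * (norm d * norm (star d \<cdot> x))"
      using cmod_cinner_le[of x "d \<cdot> (star d \<cdot> x)"]
        mult_left_mono[OF norm_bop_apply[of d "star d \<cdot> x"], of "norm x"] by simp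
    finally show "norm (star d \<cdot> x) \<le> norm d * norm x"
      by (cases "norm (star d \<cdot> x) = 0") (auto simp: power2_eq_square mult_ac)
  qed simp
  show "norm (star a * a) = (norm a)\<^sup>2"
  proof (rule antisym)
    show "norm (star a * a) \<le> (norm a)\<^sup>2"
      using norm_mult_ineq[of "star a" a] mult_right_mono[OF star_le[of a], of "norm a"]
      by (simp add: power2_eq_square)
    have "norm a \<le> sqrt (norm (star a * a))"
    proof (rule norm_bop_bound)
      fix x
      have "(norm (a \<cdot> x))\<^sup>2 = cmod (cinner x ((star a * a) \<cdot> x))"
        unfolding bop_mult_apply cinner_star_right cinner_self norm_of_real by simp
      also have "\<dots> \<le> norm x * (norm (star a * a) * norm x)"
        using cmod_cinner_le[of x "(star a * a) \<cdot> x"]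
          mult_left_mono[OF norm_bop_apply[of "star a * a" x], of "norm x"] by simp
      finally have "(norm (a \<cdot> x))\<^sup>2 \<le> (sqrt (norm (star a * a)) * norm x)\<^sup>2"
        by (simp add: power_mult_distrib power2_eq_square[of "norm x"] mult_ac)
      then show "norm (a \<cdot> x) \<le> sqrt (norm (star a * a)) * norm x"
        by (rule power2_le_imp_le) simp
    qed simp
    then have "(norm a)\<^sup>2 \<le> (sqrt (norm (star a * a)))\<^sup>2"
      by (intro power_mono) auto
    then show "(norm a)\<^sup>2 \<le> norm (star a * a)" by simp
  qed
qed

end


subsection \<open>Representations, projections and Rota--Baxter operators\<close>

text \<open>The zero space and the zero representation on a one-dimensional space count as irreducible.\<close>

definition irreducible_rep :: "('a \<Rightarrow> 'h::chilbert_space bop) \<Rightarrow> bool"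
  where "irreducible_rep \<pi> \<longleftrightarrow>
    (\<forall>S. csubspace S \<and> closed S \<and> (\<forall>a. \<forall>x\<in>S. \<pi> a \<cdot> x \<in> S) \<longrightarrow> S = {0} \<or> S = UNIV)"

definition is_projection :: "'h::chilbert_space bop \<Rightarrow> bool"
  where "is_projection p \<longleftrightarrow> p * p = p \<and> star p = p"

definition nontrivial_projection :: "'h::chilbert_space bop \<Rightarrow> bool"
  where "nontrivial_projection p \<longleftrightarrow> is_projection p \<and> p \<noteq> 0 \<and> p \<noteq> 1"

definition rota_baxter :: "complex \<Rightarrow> ('h::chilbert_space bop \<Rightarrow> 'h bop) \<Rightarrow> bool"
  where "rota_baxter w P \<longleftrightarrow> clinear P \<and>
    (\<forall>a b. P a * P b = P (a * P b) + P (P a * b) + w *\<^sub>C P (a * b))"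

definition symmetric_on :: "'h::chilbert_space bop set \<Rightarrow> ('h bop \<Rightarrow> 'h bop) \<Rightarrow> bool"
  where "symmetric_on A P \<longleftrightarrow> (\<forall>a\<in>A. P (star a) = star (P a))"

definition matches_on ::
    "complex \<Rightarrow> 'h::chilbert_space bop set \<Rightarrow> ('h bop \<Rightarrow> 'h bop) \<Rightarrow> ('h \<Rightarrow> 'h) \<Rightarrow> bool"
  where "matches_on w A P f \<longleftrightarrow>
    (\<forall>a\<in>A. \<forall>x. P a \<cdot> f x = f (P a \<cdot> x) + f (a \<cdot> f x) + w *\<^sub>C f (a \<cdot> x))"

end

theory Submission
  imports Defs
begin

text \<open>
  Write \<open>q = 1 - p\<close>. For weight \<open>-1\<close> the matching condition is the operator identity
  \<open>P(a) p = p P(a) - p a q\<close>. Compressing it by \<open>q\<close> on the left and \<open>p\<close> on the right gives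
  \<open>q P(a) p = 0\<close>; compressing it by \<open>p\<close> on the left and \<open>q\<close> on the right gives
  \<open>p P(a) q = p a q\<close>. Symmetry of \<open>P\<close> on a star-closed set turns the first equation, for
  \<open>a\<^sup>*\<close>, into \<open>p P(a) q = 0\<close>. Hence \<open>p a q = 0\<close>, that is \<open>p a = p a p\<close>, for all \<open>a\<close> in the
  image of the representation. Taking adjoints once more, \<open>a p = p a p\<close>: the range of \<open>p\<close> is a
  closed invariant subspace, and it is proper and nonzero as \<open>p\<close> is nontrivial.

  Conversely, given a closed invariant subspace \<open>S\<close>, let \<open>p\<close> be the orthogonal projection onto
  \<open>S\<close>. Invariance of \<open>S\<close> gives \<open>a p = p a p\<close>, so \<open>p a = p a p\<close> by adjoints, and then the zero
  operator, which satisfies every Rota-Baxter identity, matches \<open>p\<close>. The analytic content is the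
  existence of \<open>p\<close>, which rests on nearest points (\<open>nearest_point_exists\<close>) and their
  orthogonality (\<open>shortest_vector_orthogonal\<close>); the algebra is in
  \<open>matching_projection_absorbs\<close>.
\<close>

section \<open>Orthogonal projections onto closed subspaces\<close>

lemma cinner_zero_right [simp]: "cinner (x :: 'a::complex_inner) 0 = 0"
  using cinner_add_right[of x 0 0] by simp

lemma cinner_diff_right: "cinner x (y - z) = cinner x y - cinner (x :: 'a::complex_inner) z"
  using cinner_add_right[of x "y - z" z] by simp

lemma cinner_minus_right: "cinner x (- y) = - cinner (x :: 'a::complex_inner) y"
  using cinner_diff_right[of x 0 y] by simp

lemma parallelogram_law:
  fixes x y :: "'a::complex_inner"
  shows "(norm (x + y))\<^sup>2 + (norm (x - y))\<^sup>2 = 2 * (norm x)\<^sup>2 + 2 * (norm y)\<^sup>2"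
  using norm_add_sq[of x y] norm_add_sq[of x "- y"] by (simp add: cinner_minus_right)

text \<open>
  Midpoints of points of \<open>S\<close> stay in \<open>S\<close>, so the parallelogram law forces two points that almost
  attain the distance from \<open>x\<close> to be close to each other: a minimizing sequence is Cauchy.
\<close>

lemma nearest_point_exists:
  fixes x :: "'a::chilbert_space"
  assumes S: "convex S" "closed S" "S \<noteq> {}"
  shows "\<exists>m\<in>S. \<forall>s\<in>S. norm (x - m) \<le> norm (x - s)"
proof -
  define d where "d = infdist x S"
  have d0: "0 \<le> d" unfolding d_def by (rule infdist_nonneg)
  have d_le: "d \<le> norm (x - s)" if "s \<in> S" for s
    unfolding d_def using infdist_le[OF that, of x] by (simp add: dist_norm)
  have "\<exists>s\<in>S. (norm (x - s))\<^sup>2 < d\<^sup>2 + 1 / real (Suc n)" for n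
  proof -
    have "d < sqrt (d\<^sup>2 + 1 / real (Suc n))"
      using d0 by (intro real_less_rsqrt) simp
    then obtain s where "s \<in> S" and "dist x s < sqrt (d\<^sup>2 + 1 / real (Suc n))"
      unfolding d_def infdist_notempty[OF S(3)]
      by (subst (asm) (1) cINF_less_iff) (use S(3) in auto)
    moreover from this(2) have "(dist x s)\<^sup>2 < (sqrt (d\<^sup>2 + 1 / real (Suc n)))\<^sup>2"
      by (intro power_strict_mono) auto
    ultimately show ?thesis by (intro bexI[of _ s]) (auto simp: dist_norm)
  qed
  then obtain X where XS: "\<And>n. X n \<in> S"
    and X: "\<And>n. (norm (x - X n))\<^sup>2 < d\<^sup>2 + 1 / real (Suc n)" by metis
  have close: "(norm (s - t))\<^sup>2 \<le> 2 * ((norm (x - s))\<^sup>2 - d\<^sup>2) + 2 * ((norm (x - t))\<^sup>2 - d\<^sup>2)"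
    if "s \<in> S" "t \<in> S" for s t
  proof -
    have "(1/2) *\<^sub>R s + (1/2) *\<^sub>R t \<in> S"
      using S(1) that by (auto simp: convex_def)
    then have "d\<^sup>2 \<le> (norm (x - ((1/2) *\<^sub>R s + (1/2) *\<^sub>R t)))\<^sup>2"
      using d_le d0 by (intro power_mono) auto
    moreover have "(x - s) + (x - t) = 2 *\<^sub>R (x - ((1/2) *\<^sub>R s + (1/2) *\<^sub>R t))"
      by (simp add: algebra_simps scaleR_2)
    then have "norm ((x - s) + (x - t)) = 2 * norm (x - ((1/2) *\<^sub>R s + (1/2) *\<^sub>R t))"
      by (metis norm_scaleR abs_numeral)
    ultimately have "4 * d\<^sup>2 \<le> (norm ((x - s) + (x - t)))\<^sup>2"
      by (simp add: power_mult_distrib)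
    moreover have "norm ((x - s) - (x - t)) = norm (s - t)"
      by (simp add: norm_minus_commute)
    ultimately show ?thesis
      using parallelogram_law[of "x - s" "x - t"] by simp
  qed
  have "Cauchy X"
  proof (rule metric_CauchyI)
    fix e :: real assume e: "e > 0"
    then have "e\<^sup>2 / 4 > 0" by simp
    then obtain N where N: "inverse (real (Suc N)) < e\<^sup>2 / 4" using reals_Archimedean by blast
    have small: "(norm (x - X k))\<^sup>2 - d\<^sup>2 < e\<^sup>2 / 4" if "k \<ge> N" for k
    proof -
      have "1 / real (Suc k) \<le> inverse (real (Suc N))" using that by (simp add: field_simps)
      then show ?thesis using X[of k] N by linarith
    qed
    have "dist (X i) (X j) < e" if "i \<ge> N" "j \<ge> N" for i j
    proof -
      have "(norm (X i - X j))\<^sup>2 < e\<^sup>2"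
        using close[OF XS XS, of i j] small[OF that(1)] small[OF that(2)] by argo
      then show ?thesis using e by (simp add: dist_norm power_less_imp_less_base)
    qed
    then show "\<exists>M. \<forall>i\<ge>M. \<forall>j\<ge>M. dist (X i) (X j) < e" by blast
  qed
  then obtain m where m: "X \<longlonglongrightarrow> m" using Cauchy_convergent convergent_def by blast
  have "m \<in> S" using S(2) XS m by (metis closed_sequentially)
  have "(\<lambda>n. (norm (x - X n))\<^sup>2) \<longlonglongrightarrow> (norm (x - m))\<^sup>2"
    by (intro tendsto_intros m)
  moreover have "(\<lambda>n. d\<^sup>2 + 1 / real (Suc n)) \<longlonglongrightarrow> d\<^sup>2 + 0"
    by (intro tendsto_intros LIMSEQ_Suc[OF lim_1_over_n])
  ultimately have "(norm (x - m))\<^sup>2 \<le> d\<^sup>2 + 0"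
    by (rule LIMSEQ_le) (use X less_imp_le in blast)
  then have "norm (x - m) \<le> d" using d0 by (simp add: power2_le_iff_abs_le)
  then have "norm (x - m) \<le> norm (x - s)" if "s \<in> S" for s
    using d_le[OF that] by linarith
  then show ?thesis using \<open>m \<in> S\<close> by blast
qed

text \<open>
  If \<open>z\<close> is a shortest vector of its coset modulo \<open>S\<close>, then moving \<open>z\<close> a short way against its
  component along some \<open>s\<close> in \<open>S\<close> cannot shorten it, so that component vanishes.
\<close>

lemma shortest_vector_orthogonal:
  fixes z s :: "'a::complex_inner"
  assumes min: "\<And>c. norm z \<le> norm (z - c *\<^sub>C s)"
  shows "cinner s z = 0"
proof -
  define c where "c = cinner s z"
  \<comment> \<open>Any step length \<open>t > 0\<close> with \<open>t * (norm s)\<^sup>2 < 2\<close> would do; this one avoids the case \<open>s = 0\<close>.\<close>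
  define t where "t = 1 / (1 + (norm s)\<^sup>2)"
  have pos: "1 + (norm s)\<^sup>2 > 0" by (simp add: add_pos_nonneg)
  have t: "0 < t" "t * (norm s)\<^sup>2 \<le> 1"
    using pos unfolding t_def by (auto simp: field_simps)
  have "cinner z s = cnj c" unfolding c_def by (rule cinner_commute)
  then have inner: "Re (cinner z (- ((of_real t * c) *\<^sub>C s))) = - t * (cmod c)\<^sup>2"
    by (simp add: cinner_minus_right cinner_scaleC_right cmod_power2)
      (simp add: power2_eq_square algebra_simps)
  have "(norm z)\<^sup>2 \<le> (norm (z - (of_real t * c) *\<^sub>C s))\<^sup>2"
    using min by (intro power_mono) auto
  also have "\<dots> = (norm z)\<^sup>2 - 2 * t * (cmod c)\<^sup>2 + (t * cmod c * norm s)\<^sup>2"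
    using norm_add_sq[of z "- ((of_real t * c) *\<^sub>C s)"] t(1) unfolding inner
    by (simp add: norm_scaleC norm_mult)
  also have "(t * cmod c * norm s)\<^sup>2 = (t * (cmod c)\<^sup>2) * (t * (norm s)\<^sup>2)"
    by (simp add: power2_eq_square)
  also have "\<dots> \<le> (t * (cmod c)\<^sup>2) * 1"
    using t by (intro mult_left_mono) auto
  finally have "t * (cmod c)\<^sup>2 \<le> 0" by simp
  then show ?thesis using t(1) unfolding c_def by (simp add: mult_le_0_iff)
qed

lemma csubspace_convex:
  fixes S :: "'a::complex_vector set"
  assumes "csubspace S"
  shows "convex S"
  unfolding convex_def scaleR_scaleC
  using assms by (auto intro: complex_vector.subspace_add complex_vector.subspace_scale)

lemma orthogonal_decomposition:
  fixes S :: "'a::chilbert_space set"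
  assumes S: "csubspace S" "closed S"
  shows "\<exists>m\<in>S. \<forall>s\<in>S. cinner s (x - m) = 0"
proof -
  have "S \<noteq> {}" using complex_vector.subspace_0[OF S(1)] by blast
  from nearest_point_exists[OF csubspace_convex[OF S(1)] S(2) this]
  obtain m where m: "m \<in> S" and min: "\<And>s. s \<in> S \<Longrightarrow> norm (x - m) \<le> norm (x - s)" by blast
  have "cinner s (x - m) = 0" if "s \<in> S" for s
  proof (rule shortest_vector_orthogonal)
    fix c
    have "m + c *\<^sub>C s \<in> S"
      using S(1) m that by (intro complex_vector.subspace_add complex_vector.subspace_scale)
    from min[OF this] show "norm (x - m) \<le> norm (x - m - c *\<^sub>C s)"
      by (simp add: algebra_simps)
  qed
  then show ?thesis using m by blast
qed

lemma projection_onto_closed_subspace: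
  fixes S :: "'h::chilbert_space set"
  assumes S: "csubspace S" "closed S"
  shows "\<exists>p. is_projection p \<and> range ((\<cdot>) p) = S"
proof -
  have "\<forall>x. \<exists>m. m \<in> S \<and> (\<forall>s\<in>S. cinner s (x - m) = 0)"
    using orthogonal_decomposition[OF S] by blast
  from choice[OF this] obtain g where G: "\<forall>x. g x \<in> S \<and> (\<forall>s\<in>S. cinner s (x - g x) = 0)" ..
  have gS: "g x \<in> S" for x using G by blast
  have g: "cinner s (x - g x) = 0" if "s \<in> S" for x s using G that by blast
  \<comment> \<open>Linearity and idempotence of \<open>g\<close> both come from uniqueness of the decomposition.\<close>
  have uniq: "g x = m" if "m \<in> S" and m: "\<And>s. s \<in> S \<Longrightarrow> cinner s (x - m) = 0" for x m
  proof -
    have "g x - m \<in> S" using S(1) gS that(1) by (intro complex_vector.subspace_diff)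
    from g[OF this] m[OF this] have "cinner (g x - m) (g x - m) = 0"
      by (simp add: cinner_diff_right)
    then show ?thesis by (simp add: cinner_self)
  qed
  have add: "g (x + y) = g x + g y" for x y
  proof (rule uniq)
    show "g x + g y \<in> S" using S(1) gS by (intro complex_vector.subspace_add)
    show "cinner s (x + y - (g x + g y)) = 0" if "s \<in> S" for s
      using g[OF that, of x] g[OF that, of y] by (simp add: cinner_diff_right cinner_add_right)
  qed
  have scale: "g (c *\<^sub>C x) = c *\<^sub>C g x" for c x
  proof (rule uniq)
    show "c *\<^sub>C g x \<in> S" using S(1) gS by (intro complex_vector.subspace_scale)
    show "cinner s (c *\<^sub>C x - c *\<^sub>C g x) = 0" if "s \<in> S" for s
      using g[OF that, of x] by (simp add: cinner_diff_right cinner_scaleC_right)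
  qed
  have fix_S: "g s = s" if "s \<in> S" for s
    by (rule uniq[OF that]) simp
  have bound: "norm (g x) \<le> norm x * 1" for x
  proof -
    have "(norm x)\<^sup>2 = (norm (g x))\<^sup>2 + (norm (x - g x))\<^sup>2"
      using norm_add_sq[of "g x" "x - g x"] g[OF gS, of x x] by simp
    then have "(norm (g x))\<^sup>2 \<le> (norm x)\<^sup>2" by simp
    then have "norm (g x) \<le> norm x" by (rule power2_le_imp_le) simp
    then show ?thesis by simp
  qed
  have "bounded_linear g"
    by (rule bounded_linear_intro[OF add _ bound]) (simp add: scaleR_scaleC scale)
  define p where "p = Abs_bop (Blinfun g)"
  have p: "p \<cdot> x = g x" for x
    using \<open>bounded_linear g\<close> unfolding p_def
    by (simp add: bop_apply.rep_eq Abs_bop_inverse bounded_linear_Blinfun_apply scale)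
  have "p * p = p"
    by (rule bop_eqI) (simp add: bop_mult_apply p fix_S gS)
  moreover have "star p = p"
  proof (rule bop_eqI, rule cinner_eqI)
    fix x y
    \<comment> \<open>Both \<open>cinner x (g y)\<close> and \<open>cinner (g x) y\<close> equal \<open>cinner (g x) (g y)\<close>.\<close>
    have "cinner (g y) x = cinner (g y) (g x)"
      using g[OF gS, of y x] by (simp add: cinner_diff_right)
    then have "cinner x (g y) = cinner (g x) (g y)"
      by (metis cinner_commute)
    moreover have "cinner (g x) y = cinner (g x) (g y)"
      using g[OF gS, of x y] by (simp add: cinner_diff_right)
    ultimately show "cinner (star p \<cdot> x) y = cinner (p \<cdot> x) y"
      by (simp add: cinner_star_left p)
  qed
  moreover have "range ((\<cdot>) p) = S"
    using gS fix_S by (auto simp: p image_iff) metis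
  ultimately show ?thesis unfolding is_projection_def by blast
qed

lemma closed_range_idempotent:
  assumes "p * p = (p :: 'h::complex_normed_vector bop)"
  shows "closed (range ((\<cdot>) p))"
proof -
  have "bounded_linear ((\<cdot>) p)"
    by (rule bounded_linear_intro[of _ "norm p"])
      (simp_all add: bop_apply_add bop_apply_scaleR norm_bop_apply mult.commute[of "norm _" "norm p"])
  then have "closed {x. p \<cdot> x = x}"
    by (intro closed_Collect_eq continuous_intros)
      (simp_all add: linear_continuous_on)
  moreover have "p \<cdot> (p \<cdot> x) = p \<cdot> x" for x
    by (metis assms bop_mult_apply)
  then have "range ((\<cdot>) p) = {x. p \<cdot> x = x}"
    by (auto simp: image_iff) metis
  ultimately show ?thesis by simp
qed

lemma range_bop_trivial_iff:
  assumes "p * p = (p :: 'h::complex_normed_vector bop)"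
  shows "range ((\<cdot>) p) = {0} \<longleftrightarrow> p = 0" "range ((\<cdot>) p) = UNIV \<longleftrightarrow> p = 1"
proof -
  show "range ((\<cdot>) p) = {0} \<longleftrightarrow> p = 0"
  proof
    assume "range ((\<cdot>) p) = {0}"
    then have "p \<cdot> x = 0" for x by blast
    then show "p = 0" by (intro bop_eqI) (simp add: bop_zero_apply)
  qed (auto simp: bop_zero_apply)
  show "range ((\<cdot>) p) = UNIV \<longleftrightarrow> p = 1"
  proof
    assume surj: "range ((\<cdot>) p) = UNIV"
    have "p \<cdot> x = x" for x
    proof -
      obtain y where "x = p \<cdot> y" using surj by blast
      then show ?thesis by (metis assms bop_mult_apply)
    qed
    then show "p = 1" by (intro bop_eqI) (simp add: bop_one_apply)
  qed (auto simp: bop_one_apply)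
qed


section \<open>Invariant subspaces, projections and matching operators\<close>

lemma range_invariant_iff:
  assumes "p * p = (p :: 'h::complex_normed_vector bop)"
  shows "(\<forall>x\<in>range ((\<cdot>) p). a \<cdot> x \<in> range ((\<cdot>) p)) \<longleftrightarrow> a * p = p * a * p"
proof
  assume inv: "\<forall>x\<in>range ((\<cdot>) p). a \<cdot> x \<in> range ((\<cdot>) p)"
  show "a * p = p * a * p"
  proof (rule bop_eqI)
    fix x
    from inv obtain y where "a \<cdot> (p \<cdot> x) = p \<cdot> y" by blast
    then show "(a * p) \<cdot> x = (p * a * p) \<cdot> x"
      by (metis assms bop_mult_apply)
  qed
next
  assume "a * p = p * a * p"
  then have "a \<cdot> (p \<cdot> x) = p \<cdot> (a \<cdot> (p \<cdot> x))" for x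
    by (metis bop_mult_apply)
  then show "\<forall>x\<in>range ((\<cdot>) p). a \<cdot> x \<in> range ((\<cdot>) p)" by blast
qed

text \<open>
  For a star-closed set of operators, invariance of a subspace and of its orthogonal complement
  are the same condition.
\<close>

lemma absorb_left_iff_absorb_right:
  fixes p :: "'a::cstar_algebra"
  assumes "star p = p" and "\<And>a. a \<in> A \<Longrightarrow> star a \<in> A"
  shows "(\<forall>a\<in>A. a * p = p * a * p) \<longleftrightarrow> (\<forall>a\<in>A. p * a = p * a * p)"
proof -
  have "star (a * p) = p * star a" "star (p * a) = star a * p"
    "star (p * a * p) = p * star a * p" for a
    by (simp_all add: star_mult assms(1) mult.assoc)
  then show ?thesis using assms(2) by (metis star_star)
qed

lemma range_star_closed:
  assumes "star_hom \<pi>" and "a \<in> range \<pi>"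
  shows "star a \<in> range \<pi>"
proof -
  obtain b where "a = \<pi> b" using assms(2) by blast
  then have "star a = \<pi> (star b)" using assms(1) by (simp add: star_hom_def)
  then show ?thesis by simp
qed

lemma matches_on_bop_iff:
  "matches_on w A P ((\<cdot>) p) \<longleftrightarrow>
    (\<forall>a\<in>A. P a * p = p * P a + p * a * p + w *\<^sub>C (p * a))"
proof -
  have "(P a * p) \<cdot> x = P a \<cdot> (p \<cdot> x)"
    "(p * P a + p * a * p + w *\<^sub>C (p * a)) \<cdot> x
      = p \<cdot> (P a \<cdot> x) + p \<cdot> (a \<cdot> (p \<cdot> x)) + w *\<^sub>C (p \<cdot> (a \<cdot> x))" for a x
    by (simp_all add: bop_mult_apply bop_add_apply bop_scaleC_apply)
  then show ?thesis unfolding matches_on_def by (metis bop_eqI)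
qed

text \<open>
  Matching alone makes \<open>P a\<close> leave the range of \<open>p\<close> invariant; symmetry upgrades this to
  \<open>P a\<close> commuting with \<open>p\<close>, and then the matching identity collapses to the claim.
\<close>

lemma matching_projection_absorbs:
  assumes p: "is_projection p"
    and closed: "\<And>a. a \<in> A \<Longrightarrow> star a \<in> A"
    and sym: "symmetric_on A P"
    and match: "matches_on (- 1) A P ((\<cdot>) p)"
    and a: "a \<in> A"
  shows "p * a = p * a * p"
proof -
  have pp: "p * p = p" and star_p: "star p = p"
    using p unfolding is_projection_def by auto
  have m: "P b * p = p * P b + p * b * p - p * b" if "b \<in> A" for b
    using match that unfolding matches_on_bop_iff by (simp add: complex_vector.scale_minus_left)
  have corner: "P b * p = p * P b * p" if "b \<in> A" for b
  proof -
    \<comment> \<open>Multiplying the matching identity by \<open>p\<close> on the right cancels the terms in \<open>b\<close>.\<close>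
    have "P b * p * p = (p * P b + p * b * p - p * b) * p"
      using m[OF that] by simp
    then show ?thesis by (simp add: algebra_simps pp)
  qed
  have "star (P (star a) * p) = star (p * P (star a) * p)"
    using corner[OF closed[OF a]] by simp
  then have "p * P a = p * P a * p"
    using sym a unfolding symmetric_on_def
    by (simp add: star_mult star_p star_star mult.assoc pp)
  with corner[OF a] have "P a * p = p * P a" by simp
  with m[OF a] show ?thesis by simp
qed

lemma zero_rota_baxter: "rota_baxter w (\<lambda>_. 0)"
  by (simp add: rota_baxter_def clinear_iff)

theorem corollary3p11:
  fixes \<pi> :: "'a::cstar_algebra \<Rightarrow> 'h::chilbert_space bop"
  assumes "star_hom \<pi>"
  shows "irreducible_rep \<pi> \<longleftrightarrow>
    \<not> (\<exists>P. rota_baxter (- 1) P \<and>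
          (\<exists>p. nontrivial_projection p \<and> symmetric_on (range \<pi>) P \<and>
               matches_on (- 1) (range \<pi>) P ((\<cdot>) p)))"
proof (intro iffI notI)
  assume irr: "irreducible_rep \<pi>"
  assume "\<exists>P. rota_baxter (- 1) P \<and>
          (\<exists>p. nontrivial_projection p \<and> symmetric_on (range \<pi>) P \<and>
               matches_on (- 1) (range \<pi>) P ((\<cdot>) p))"
  then obtain P p where p: "is_projection p" and nontriv: "p \<noteq> 0" "p \<noteq> 1"
    and sym: "symmetric_on (range \<pi>) P" and match: "matches_on (- 1) (range \<pi>) P ((\<cdot>) p)"
    unfolding nontrivial_projection_def by blast
  have pp: "p * p = p" and star_p: "star p = p"
    using p unfolding is_projection_def by auto
  have "\<forall>a\<in>range \<pi>. p * a = p * a * p"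
    using matching_projection_absorbs[OF p range_star_closed[OF assms] sym match] by blast
  then have "\<forall>a\<in>range \<pi>. a * p = p * a * p"
    using absorb_left_iff_absorb_right[OF star_p range_star_closed[OF assms]] by blast
  then have "\<forall>a. \<forall>x\<in>range ((\<cdot>) p). \<pi> a \<cdot> x \<in> range ((\<cdot>) p)"
    using range_invariant_iff[OF pp] by blast
  moreover have "csubspace (range ((\<cdot>) p))"
    using module_hom.subspace_image[OF _ complex_vector.subspace_UNIV] clinear_bop_apply
    unfolding module_hom_iff_linear by blast
  ultimately have "range ((\<cdot>) p) = {0} \<or> range ((\<cdot>) p) = UNIV"
    using irr closed_range_idempotent[OF pp] unfolding irreducible_rep_def by blast
  then show False using nontriv range_bop_trivial_iff[OF pp] by blast
next
  assume no: "\<not> (\<exists>P. rota_baxter (- 1) P \<and>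
          (\<exists>p. nontrivial_projection p \<and> symmetric_on (range \<pi>) P \<and>
               matches_on (- 1) (range \<pi>) P ((\<cdot>) p)))"
  show "irreducible_rep \<pi>"
    unfolding irreducible_rep_def
  proof (intro allI impI, elim conjE)
    fix S :: "'h set"
    assume S: "csubspace S" "closed S" and inv: "\<forall>a. \<forall>x\<in>S. \<pi> a \<cdot> x \<in> S"
    obtain p where p: "is_projection p" and range_p: "range ((\<cdot>) p) = S"
      using projection_onto_closed_subspace[OF S] by blast
    have pp: "p * p = p" and star_p: "star p = p"
      using p unfolding is_projection_def by auto
    have "\<forall>a\<in>range \<pi>. a * p = p * a * p"
      using inv range_invariant_iff[OF pp] unfolding range_p by blast
    then have "\<forall>a\<in>range \<pi>. p * a = p * a * p"
      using absorb_left_iff_absorb_right[OF star_p range_star_closed[OF assms]] by blast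
    then have "matches_on (- 1) (range \<pi>) (\<lambda>_. 0) ((\<cdot>) p)"
      unfolding matches_on_bop_iff by (simp add: complex_vector.scale_minus_left)
    moreover have "symmetric_on (range \<pi>) (\<lambda>_. 0 :: 'h bop)"
      using star_scaleC[of 0 "0 :: 'h bop"] by (simp add: symmetric_on_def)
    ultimately have "\<not> nontrivial_projection p"
      using no zero_rota_baxter by blast
    then show "S = {0} \<or> S = UNIV"
      using p range_bop_trivial_iff[OF pp] range_p unfolding nontrivial_projection_def by blast
  qed
qed

end
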